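(* Let $P=([n],\preceq)$ be a poset, let $0\le m\le n$, and let $\mathcal{C}\subseteq F^n$ be a code with $|\mathcal{C}|=2^{n-m}$. Then $\mathcal{C}$ is an $m$-error-correcting $P$-code if and only if the following two conditions hold: (a) $\mathcal{I}_P^{m}$ contains exactly one ideal $I$; (b) there is a function $f:2^{[n]\setminus I}\to 2^{I}$ such that $\mathcal{C}=\{Y\cup f(Y)\mid Y\in 2^{[n]\setminus I}\}$. Moreover, every $m$-error-correcting $P$-code of cardinality $2^{n-m}$ is an $m$-perfect $P$-code.
   Context: $[n]=\{1,\dots,n\}$ and $P=([n],\preceq)$ is a partially ordered set. Subsets of $[n]$ are identified with their characteristic vectors in $F^n=\{0,1\}^n=2^{[n]}$; the sum $x+y$ is the symmetric difference (coordinatewise addition mod 2). For a set $S$, $2^S$ is the set of all subsets of $S$. An ideal is a set $I\subseteq[n]$ such that $a\in I$ and $b\preceq a$ imply $b\in I$. For $X\subseteq [n]$, ${<}X{>}$ is the smallest ideal containing $X$. $\mathcal{I}_P^r$ is the set of ideals of cardinality $r$. The $P$-weight of $x\in F^n$ is $w_P(x)=|{<}x{>}|$ and $\mathcal{B}_P^r=\{x\in F^n: w_P(x)\le r\}$. A $P$-code is a subset $\mathcal{C}\subseteq F^n$; it is $r$-error-correcting if every $x\in F^n$ has at most one representation $x=c+b$ with $c\in\mathcal{C}$, $b\in\mathcal{B}_P^r$, and $r$-perfect if every $x\in F^n$ has exactly one such representation. *)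

theory Defs
  imports Complex_Main "HOL-Library.FuncSet"
begin

text \<open>
  A poset \<open>P = ([n], \<preceq>)\<close> is a relation \<open>r\<close> with \<^term>\<open>partial_order_on {1..n} r\<close>, where
  \<^term>\<open>(a, b) \<in> r\<close> means \<open>a \<preceq> b\<close>.  Vectors of \<open>F\<^sup>n\<close> are identified with subsets of \<open>[n]\<close>,
  so \<open>F\<^sup>n\<close> is \<^term>\<open>Pow {1..n}\<close> and vector addition is \<^term>\<open>sym_diff\<close>.
\<close>

definition poset_ideal :: "nat \<Rightarrow> (nat \<times> nat) set \<Rightarrow> nat set \<Rightarrow> bool" where
  "poset_ideal n r I \<longleftrightarrow> I \<subseteq> {1..n} \<and> (\<forall>a b. a \<in> I \<and> (b, a) \<in> r \<longrightarrow> b \<in> I)"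

definition gen_ideal :: "nat \<Rightarrow> (nat \<times> nat) set \<Rightarrow> nat set \<Rightarrow> nat set" where
  "gen_ideal n r X = poset_ideal n r hull X"

definition ideals_of_card :: "nat \<Rightarrow> (nat \<times> nat) set \<Rightarrow> nat \<Rightarrow> nat set set" where
  "ideals_of_card n r k = {I. poset_ideal n r I \<and> card I = k}"

definition P_weight :: "nat \<Rightarrow> (nat \<times> nat) set \<Rightarrow> nat set \<Rightarrow> nat" where
  "P_weight n r x = card (gen_ideal n r x)"

definition P_ball :: "nat \<Rightarrow> (nat \<times> nat) set \<Rightarrow> nat \<Rightarrow> nat set set" where
  "P_ball n r k = {x \<in> Pow {1..n}. P_weight n r x \<le> k}"

definition error_correcting :: "nat \<Rightarrow> (nat \<times> nat) set \<Rightarrow> nat \<Rightarrow> nat set set \<Rightarrow> bool" where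
  "error_correcting n r k C \<longleftrightarrow> C \<subseteq> Pow {1..n} \<and>
     (\<forall>x \<in> Pow {1..n}. \<exists>\<^sub>\<le>\<^sub>1 p. p \<in> C \<times> P_ball n r k \<and> x = sym_diff (fst p) (snd p))"

definition perfect_code :: "nat \<Rightarrow> (nat \<times> nat) set \<Rightarrow> nat \<Rightarrow> nat set set \<Rightarrow> bool" where
  "perfect_code n r k C \<longleftrightarrow> C \<subseteq> Pow {1..n} \<and>
     (\<forall>x \<in> Pow {1..n}. \<exists>!p. p \<in> C \<times> P_ball n r k \<and> x = sym_diff (fst p) (snd p))"

end

(*
  A poset with n elements has ideals of every cardinality up to n, and every ideal of cardinality
  at most m lies in one of cardinality m: add minimal elements of the complement one at a time.
  So the ball of radius m is the union of the power sets of the ideals of cardinality m. In particular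
  it has at least 2^m elements, while 2^(n-m) disjoint translates of it fit into
  the 2^n words only if it has exactly 2^m; hence the ideal I is unique and the ball is the
  power set of I. Error correction then says that distinct codewords differ outside I, and counting
  shows that C meets every coset of the power set of I, so C is the graph of a function.
*)
theory Submission
  imports Defs
begin

lemma gen_ideal_subset_iff:
  assumes "poset_ideal n r I"
  shows "gen_ideal n r X \<subseteq> I \<longleftrightarrow> X \<subseteq> I"
  using assms by (simp add: gen_ideal_def subset_hull)

lemma poset_ideal_gen_ideal:
  assumes "r \<subseteq> {1..n} \<times> {1..n}" and "X \<subseteq> {1..n}"
  shows "poset_ideal n r (gen_ideal n r X)"
proof -
  \<comment> \<open>As an ideal containing \<open>X\<close>, \<open>[n]\<close> keeps the hull from
    being the intersection of an empty family, which would be all of \<open>nat\<close>.\<close>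
  have "poset_ideal n r {1..n}"
    using assms(1) by (auto simp: poset_ideal_def)
  then show ?thesis
    using assms(2) unfolding gen_ideal_def hull_def poset_ideal_def by blast
qed

lemma ideal_extend_one:
  assumes "partial_order_on {1..n} r" and I: "poset_ideal n r I" and "I \<noteq> {1..n}"
  obtains a where "a \<notin> I" and "poset_ideal n r (insert a I)"
proof -
  have r: "r \<subseteq> {1..n} \<times> {1..n}"
    using partial_order_onD(4)[OF assms(1)] .
  \<comment> \<open>The strict part of a partial order on a finite set is well-founded, so the
    complement of \<open>I\<close> has a minimal element \<open>a\<close>; everything strictly below
    \<open>a\<close> then lies in \<open>I\<close>.\<close>
  have "wf (r - Id)"
    using partial_order_on_well_order_on[OF _ assms(1)] finite_subset[OF r] by simp
  moreover have "{1..n} - I \<noteq> {}"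
    using I \<open>I \<noteq> {1..n}\<close> by (auto simp: poset_ideal_def)
  ultimately obtain a where "a \<in> {1..n} - I" "\<And>b. (b, a) \<in> r - Id \<Longrightarrow> b \<notin> {1..n} - I"
    by (metis wfE_min')
  then have "a \<notin> I" "a \<in> {1..n}" "\<And>b. (b, a) \<in> r \<Longrightarrow> b \<in> insert a I"
    using r by blast+
  then have "poset_ideal n r (insert a I)"
    using I unfolding poset_ideal_def by blast
  with \<open>a \<notin> I\<close> show ?thesis by (rule that)
qed

lemma ideal_extend:
  assumes "partial_order_on {1..n} r" and "poset_ideal n r I" and "card I \<le> m" and "m \<le> n"
  obtains J where "I \<subseteq> J" and "J \<in> ideals_of_card n r m"
proof -
  have "\<exists>J. I \<subseteq> J \<and> J \<in> ideals_of_card n r m"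
    using assms(3,4)
  proof (induction m rule: dec_induct)
    case base
    then show ?case using assms(2) by (auto simp: ideals_of_card_def)
  next
    case (step k)
    then obtain J where J: "I \<subseteq> J" "poset_ideal n r J" "card J = k"
      by (auto simp: ideals_of_card_def)
    \<comment> \<open>The premise \<open>Suc k \<le> n\<close> is part of the induction statement;
      it leaves room to enlarge an ideal of size \<open>k\<close>.\<close>
    then have "J \<noteq> {1..n}" using step.prems by auto
    then obtain a where a: "a \<notin> J" "poset_ideal n r (insert a J)"
      using ideal_extend_one[OF assms(1) J(2)] by blast
    have "finite J" using J(2) finite_subset by (auto simp: poset_ideal_def)
    then show ?case
      using a J by (intro exI[of _ "insert a J"]) (auto simp: ideals_of_card_def)
  qed
  then show ?thesis using that by blast
qed

lemma P_ball_eq_Union_Pow: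
  assumes "partial_order_on {1..n} r" and "m \<le> n"
  shows "P_ball n r m = (\<Union>I \<in> ideals_of_card n r m. Pow I)"
proof (intro equalityI subsetI)
  have r: "r \<subseteq> {1..n} \<times> {1..n}"
    using partial_order_onD(4)[OF assms(1)] .
  fix x assume "x \<in> P_ball n r m"
  then have "x \<subseteq> {1..n}" "card (gen_ideal n r x) \<le> m"
    by (auto simp: P_ball_def P_weight_def)
  then obtain J where "gen_ideal n r x \<subseteq> J" "J \<in> ideals_of_card n r m"
    using ideal_extend[OF assms(1) poset_ideal_gen_ideal[OF r] _ assms(2)] by blast
  then show "x \<in> (\<Union>I \<in> ideals_of_card n r m. Pow I)"
    by (auto simp: ideals_of_card_def gen_ideal_subset_iff)
next
  fix x assume "x \<in> (\<Union>I \<in> ideals_of_card n r m. Pow I)"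
  then obtain I where I: "poset_ideal n r I" "card I = m" "x \<subseteq> I"
    by (auto simp: ideals_of_card_def)
  then have "I \<subseteq> {1..n}" by (simp add: poset_ideal_def)
  moreover have "gen_ideal n r x \<subseteq> I" using I by (simp add: gen_ideal_subset_iff)
  ultimately show "x \<in> P_ball n r m"
    using I card_mono[of I "gen_ideal n r x"] finite_subset[of I "{1..n}"]
    by (auto simp: P_ball_def P_weight_def)
qed

text \<open>Every sum of a codeword and a ball element stays in \<open>F^n\<close>, so letting
  \<open>x\<close> range over \<open>F^n\<close> only misses no collision. The injectivity form
  makes images countable.\<close>

lemma error_correcting_iff_inj_on:
  assumes "C \<subseteq> Pow {1..n}"
  shows "error_correcting n r m C \<longleftrightarrow> inj_on (\<lambda>(c, b). sym_diff c b) (C \<times> P_ball n r m)"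
proof -
  have "sym_diff c b \<in> Pow {1..n}" if "c \<in> C" "b \<in> P_ball n r m" for c b
    using that assms by (auto simp: P_ball_def)
  then show ?thesis
    using assms unfolding error_correcting_def inj_on_def Uniq_def
    by (simp add: split_beta) blast
qed

text \<open>The translate of \<open>Pow I\<close> by \<open>c\<close> is the coset of all words
  agreeing with \<open>c\<close> outside \<open>I\<close>. Two such cosets are equal or disjoint,
  and \<open>c - I\<close> names the coset.\<close>

lemma inj_on_sym_diff_Pow_iff:
  "inj_on (\<lambda>(c, b). sym_diff c b) (C \<times> Pow I) \<longleftrightarrow> inj_on (\<lambda>c. c - I) C"
proof
  assume L: "inj_on (\<lambda>(c, b). sym_diff c b) (C \<times> Pow I)"
  show "inj_on (\<lambda>c. c - I) C"
  proof (rule inj_onI)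
    fix c d assume "c \<in> C" "d \<in> C" "c - I = d - I"
    \<comment> \<open>Adding \<open>c \<inter> I\<close> erases the part of \<open>c\<close> inside
      \<open>I\<close>, so both sums are the common part outside \<open>I\<close>.\<close>
    moreover have "sym_diff c (c \<inter> I) = sym_diff d (d \<inter> I)"
      using \<open>c - I = d - I\<close> by blast
    ultimately show "c = d"
      using inj_onD[OF L, of "(c, c \<inter> I)" "(d, d \<inter> I)"] by auto
  qed
next
  assume R: "inj_on (\<lambda>c. c - I) C"
  show "inj_on (\<lambda>(c, b). sym_diff c b) (C \<times> Pow I)"
  proof (rule inj_onI, clarify)
    fix c b d e assume *: "c \<in> C" "d \<in> C" "b \<subseteq> I" "e \<subseteq> I" "sym_diff c b = sym_diff d e"
    then have "c - I = d - I" by blast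
    with R * have "c = d" by (auto dest: inj_onD)
    with * show "c = d \<and> b = e" by blast
  qed
qed

text \<open>An injection of \<open>C\<close> into the equally large finite set
  \<open>Pow (A - I)\<close> is onto, so each \<open>Y\<close> extends to exactly one codeword, and
  \<open>f Y\<close> is the part of that codeword inside \<open>I\<close>.\<close>

lemma inj_on_Diff_iff_graph:
  assumes "finite A" and "I \<subseteq> A" and "C \<subseteq> Pow A" and "card C = 2 ^ card (A - I)"
  shows "inj_on (\<lambda>c. c - I) C \<longleftrightarrow>
    (\<exists>f \<in> Pow (A - I) \<rightarrow> Pow I. C = {Y \<union> f Y | Y. Y \<in> Pow (A - I)})"
proof
  assume inj: "inj_on (\<lambda>c. c - I) C"
  have surj: "(\<lambda>c. c - I) ` C = Pow (A - I)"
  proof (rule card_subset_eq)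
    show "card ((\<lambda>c. c - I) ` C) = card (Pow (A - I))"
      using assms inj by (simp add: card_image card_Pow)
  qed (use assms in auto)
  \<comment> \<open>\<open>g Y\<close> is the whole codeword above \<open>Y\<close>; the function
    sought is its trace \<open>g Y \<inter> I\<close>.\<close>
  define g where "g = inv_into C (\<lambda>c. c - I)"
  have g: "g Y \<in> C" "g Y - I = Y" if "Y \<in> Pow (A - I)" for Y
    using that surj inv_into_into[of Y "\<lambda>c. c - I" C] f_inv_into_f[of Y "\<lambda>c. c - I" C]
    by (auto simp: g_def)
  have dec: "Y \<union> g Y \<inter> I = g Y" if "Y \<in> Pow (A - I)" for Y
    using g(2)[OF that] by blast
  have "C = {Y \<union> g Y \<inter> I | Y. Y \<in> Pow (A - I)}"
  proof (intro equalityI subsetI)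
    fix c assume c: "c \<in> C"
    then have "c - I \<in> Pow (A - I)" "g (c - I) = c"
      using assms(3) inv_into_f_f[OF inj] by (auto simp: g_def)
    with dec[of "c - I"] show "c \<in> {Y \<union> g Y \<inter> I | Y. Y \<in> Pow (A - I)}"
      by (intro CollectI exI[of _ "c - I"] conjI) simp_all
  next
    fix c assume "c \<in> {Y \<union> g Y \<inter> I | Y. Y \<in> Pow (A - I)}"
    then show "c \<in> C" using dec g(1) by auto
  qed
  then show "\<exists>f \<in> Pow (A - I) \<rightarrow> Pow I. C = {Y \<union> f Y | Y. Y \<in> Pow (A - I)}"
    by (intro bexI[of _ "\<lambda>Y. g Y \<inter> I"]) auto
next
  assume "\<exists>f \<in> Pow (A - I) \<rightarrow> Pow I. C = {Y \<union> f Y | Y. Y \<in> Pow (A - I)}"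
  then obtain f where f: "f \<in> Pow (A - I) \<rightarrow> Pow I" "C = {Y \<union> f Y | Y. Y \<in> Pow (A - I)}"
    by blast
  \<comment> \<open>Removing \<open>I\<close> recovers \<open>Y\<close>, hence the whole
    codeword.\<close>
  have "(Y \<union> f Y) - I = Y" if "Y \<in> Pow (A - I)" for Y
    using that funcset_mem[OF f(1) that] by blast
  then show "inj_on (\<lambda>c. c - I) C"
    unfolding f(2) by (intro inj_onI) force
qed

theorem theorem1:
  fixes n m :: nat and r :: "(nat \<times> nat) set" and C :: "nat set set"
  assumes "partial_order_on {1..n} r"
    and "m \<le> n"
    and "C \<subseteq> Pow {1..n}"
    and "card C = 2 ^ (n - m)"
  shows "(error_correcting n r m C \<longleftrightarrow>
           (\<exists>I. ideals_of_card n r m = {I} \<and>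
              (\<exists>f \<in> Pow ({1..n} - I) \<rightarrow> Pow I.
                 C = {Y \<union> f Y | Y. Y \<in> Pow ({1..n} - I)})))
       \<and> (error_correcting n r m C \<longrightarrow> perfect_code n r m C)"
proof -
  let ?B = "P_ball n r m" and ?s = "\<lambda>(c, b). sym_diff c b :: nat set"
  have ball: "?B = (\<Union>I \<in> ideals_of_card n r m. Pow I)"
    using P_ball_eq_Union_Pow[OF assms(1,2)] .
  have fin: "finite I" "I \<subseteq> {1..n}" "card I = m" if "I \<in> ideals_of_card n r m" for I
    using that finite_subset[of I "{1..n}"] by (auto simp: ideals_of_card_def poset_ideal_def)
  have sub: "?s ` (C \<times> ?B) \<subseteq> Pow {1..n}"
    using assms(3) by (auto simp: P_ball_def)
  have finB: "finite ?B" by (simp add: P_ball_def)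
  \<comment> \<open>With a single ideal the ball is \<open>Pow I\<close>, and the equivalences above
    chain together. This serves both directions of the theorem; only the uniqueness of the ideal
    remains to be derived from error correction.\<close>
  have graph_iff: "error_correcting n r m C \<longleftrightarrow>
      (\<exists>f \<in> Pow ({1..n} - I) \<rightarrow> Pow I. C = {Y \<union> f Y | Y. Y \<in> Pow ({1..n} - I)})"
    if "ideals_of_card n r m = {I}" for I
  proof -
    have I: "finite I" "I \<subseteq> {1..n}" "card I = m" using fin that by auto
    then have "card C = 2 ^ card ({1..n} - I)"
      using assms(4) by (simp add: card_Diff_subset)
    moreover have "?B = Pow I" using ball that by simp
    ultimately show ?thesis
      using inj_on_Diff_iff_graph[OF _ I(2) assms(3)] assms(3)
      by (simp add: error_correcting_iff_inj_on inj_on_sym_diff_Pow_iff)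
  qed
  have unique: "\<exists>I. ideals_of_card n r m = {I} \<and> ?B = Pow I" if ec: "error_correcting n r m C"
  proof -
    \<comment> \<open>Existence comes from enlarging the empty ideal.\<close>
    obtain I where I: "I \<in> ideals_of_card n r m"
      using ideal_extend[OF assms(1), of "{}" m] assms(2) by (auto simp: poset_ideal_def)
    \<comment> \<open>Sphere-packing bound: the sums are pairwise distinct words of
      \<open>F^n\<close>.\<close>
    have "card C * card ?B \<le> 2 ^ n"
      using ec assms(3) card_inj_on_le[OF _ sub]
      by (simp add: error_correcting_iff_inj_on card_cartesian_product card_Pow)
    then have "2 ^ (n - m) * card ?B \<le> 2 ^ (n - m) * 2 ^ m"
      using assms(2,4) by (simp flip: power_add)
    then have "card ?B \<le> card (Pow I)"
      using fin[OF I] by (simp add: card_Pow)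
    moreover have "Pow I \<subseteq> ?B" using ball I by blast
    ultimately have B: "?B = Pow I"
      using card_seteq[OF finB] by blast
    have "J = I" if "J \<in> ideals_of_card n r m" for J
    proof -
      \<comment> \<open>\<open>J\<close> itself is a word of the ball, which is
        \<open>Pow I\<close>.\<close>
      have "J \<subseteq> I" using B ball that by blast
      then show ?thesis using fin[OF I] fin[OF that] card_subset_eq by metis
    qed
    with I B show ?thesis by blast
  qed
  have "perfect_code n r m C" if ec: "error_correcting n r m C"
  proof -
    obtain I where I: "ideals_of_card n r m = {I}" "?B = Pow I" using unique[OF ec] by blast
    have inj: "inj_on ?s (C \<times> ?B)"
      using ec assms(3) by (simp add: error_correcting_iff_inj_on)
    \<comment> \<open>The packing bound is attained, so the translates of the ball cover
      \<open>F^n\<close>: every word has a representation.\<close>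
    have "card (?s ` (C \<times> ?B)) = 2 ^ (n - m) * 2 ^ m"
      using I fin[of I] assms(4) card_image[OF inj] by (simp add: card_cartesian_product card_Pow)
    then have img: "?s ` (C \<times> ?B) = Pow {1..n}"
      using assms(2) by (intro card_subset_eq[OF _ sub]) (simp_all add: card_Pow flip: power_add)
    show ?thesis
      unfolding perfect_code_def
    proof (intro conjI ballI)
      fix x assume x: "x \<in> Pow {1..n}"
      then have "x \<in> ?s ` (C \<times> ?B)" by (simp only: img)
      then obtain p where "x = ?s p" "p \<in> C \<times> ?B" by (rule imageE)
      then have "\<exists>p. p \<in> C \<times> ?B \<and> x = sym_diff (fst p) (snd p)"
        by (auto simp only: case_prod_beta)
      moreover have "\<exists>\<^sub>\<le>\<^sub>1 p. p \<in> C \<times> ?B \<and> x = sym_diff (fst p) (snd p)"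
        using ec x unfolding error_correcting_def by (elim conjE) (rule bspec)
      ultimately show "\<exists>!p. p \<in> C \<times> ?B \<and> x = sym_diff (fst p) (snd p)"
        by (rule ex1_iff_ex_Uniq[THEN iffD2, OF conjI])
    qed (rule assms(3))
  qed
  moreover have "error_correcting n r m C \<longleftrightarrow> (\<exists>I. ideals_of_card n r m = {I} \<and>
      (\<exists>f \<in> Pow ({1..n} - I) \<rightarrow> Pow I. C = {Y \<union> f Y | Y. Y \<in> Pow ({1..n} - I)}))"
    (is "_ \<longleftrightarrow> (\<exists>I. _ I \<and> ?graph I)")
  proof
    assume ec: "error_correcting n r m C"
    then obtain I where I: "ideals_of_card n r m = {I}" using unique by blast
    moreover have "?graph I" by (rule graph_iff[OF I, THEN iffD1, OF ec])
    ultimately show "\<exists>I. ideals_of_card n r m = {I} \<and> ?graph I" by (intro exI conjI)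
  next
    assume "\<exists>I. ideals_of_card n r m = {I} \<and> ?graph I"
    then show "error_correcting n r m C" by (elim exE conjE) (rule graph_iff[THEN iffD2])
  qed
  ultimately show ?thesis by (intro conjI impI)
qed

end
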